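(* In the subtraction game on $n\ge 2$ variables, regardless of the adversary's choices, after each round every variable satisfies $x_i< H_{n-1}\le 1+\ln(n-1)$, where $H_{n-1}=\sum_{j=1}^{n-1}\frac{1}{j}$ is the $(n-1)$-th harmonic number.
   Context: The subtraction game is played on $n$ non-negative real variables $x_1,\dots,x_n$, initially all zero. The game proceeds in rounds; each round consists of an increment step followed by a subtraction step. In the increment step an adversary chooses non-negative reals $\delta_1,\dots,\delta_n$ with $\sum_{i=1}^n\delta_i\le 1$ and sets $x_i\leftarrow x_i+\delta_i$ for all $i$. In the subtraction step a largest variable $x_i$ (one of maximum value) is updated by $x_i\leftarrow\max\{0,x_i-1\}$. *)

theory Defs
  imports "HOL-Analysis.Harmonic_Numbers"
begin

text \<open>
  A position on \<open>n\<close> variables is a function \<open>x :: nat \<Rightarrow> real\<close> of which only the values on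
  \<open>{1..n}\<close> are meaningful; all other arguments are left unconstrained.
\<close>

definition increment_step :: "nat \<Rightarrow> (nat \<Rightarrow> real) \<Rightarrow> (nat \<Rightarrow> real) \<Rightarrow> bool" where
  "increment_step n x y \<longleftrightarrow>
     (\<exists>\<delta> :: nat \<Rightarrow> real.
        (\<forall>i\<in>{1..n}. 0 \<le> \<delta> i) \<and> (\<Sum>i=1..n. \<delta> i) \<le> 1 \<and>
        (\<forall>i\<in>{1..n}. y i = x i + \<delta> i))"

text \<open>If several variables are largest, any one of them may be the one decreased.\<close>

definition subtraction_step :: "nat \<Rightarrow> (nat \<Rightarrow> real) \<Rightarrow> (nat \<Rightarrow> real) \<Rightarrow> bool" where
  "subtraction_step n x y \<longleftrightarrow>
     (\<exists>m\<in>{1..n}.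
        (\<forall>i\<in>{1..n}. x i \<le> x m) \<and>
        y m = max 0 (x m - 1) \<and>
        (\<forall>i\<in>{1..n} - {m}. y i = x i))"

definition game_round :: "nat \<Rightarrow> (nat \<Rightarrow> real) \<Rightarrow> (nat \<Rightarrow> real) \<Rightarrow> bool" where
  "game_round n x z \<longleftrightarrow> (\<exists>y. increment_step n x y \<and> subtraction_step n y z)"

text \<open>\<open>after_rounds n t x\<close>: position \<open>x\<close> can occur after exactly \<open>t\<close> completed rounds.\<close>

inductive after_rounds :: "nat \<Rightarrow> nat \<Rightarrow> (nat \<Rightarrow> real) \<Rightarrow> bool" for n :: nat where
  start: "\<forall>i\<in>{1..n}. x i = 0 \<Longrightarrow> after_rounds n 0 x"
| step: "after_rounds n t x \<Longrightarrow> game_round n x y \<Longrightarrow> after_rounds n (Suc t) y"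

end

theory Submission
  imports Defs
begin

text \<open>
  The invariant bounds all nonempty sets of \<open>k\<close> variables at once: their average stays below
  \<open>1 + H\<^sub>n\<^sub>-\<^sub>1 - H\<^sub>k\<close>, which is \<open>H\<^sub>n\<^sub>-\<^sub>1\<close> for \<open>k = 1\<close>. If the decreased variable \<open>m\<close> is outside
  the set, adding it does not lower the average, so the bound for \<open>k + 1\<close> variables applies, at a
  cost of \<open>1 / (k + 1)\<close> for the increment. If it is inside, either the set loses the whole unit it
  gained, or all its variables were below 1 and \<open>m\<close> drops to 0.
\<close>

definition averages_bounded :: "nat \<Rightarrow> (nat \<Rightarrow> real) \<Rightarrow> bool" where
  "averages_bounded n x \<longleftrightarrow>
     (\<forall>S\<subseteq>{1..n}. S \<noteq> {} \<longrightarrow> sum x S < real (card S) * (1 + harm (n - 1) - harm (card S)))"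

lemma averages_boundedD:
  assumes "averages_bounded n x" "S \<subseteq> {1..n}" "S \<noteq> {}"
  shows "sum x S < real (card S) * (1 + harm (n - 1) - harm (card S))"
  using assms unfolding averages_bounded_def by blast

text \<open>From \<open>harm k \<le> harm n\<close> the factor in parentheses is at least
  \<open>1 - 1 / n\<close>, hence at least \<open>1 - 1 / k\<close>. This serves the round in which
  \<open>m\<close> drops to 0 and the other \<open>k - 1\<close> members are all below 1.\<close>

lemma average_bound_ge_pred:
  assumes "n \<ge> 1" "1 \<le> k" "k \<le> n"
  shows "real k - 1 \<le> real k * (1 + harm (n - 1) - harm k)"
proof -
  have "harm k \<le> (harm n :: real)"
    using assms by (intro harm_mono) auto
  also have "\<dots> = harm (n - 1) + 1 / real n"
    using assms harm_Suc[of "n - 1", where ?'a = real] by (simp add: field_simps)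
  also have "1 / real n \<le> 1 / real k"
    using assms by (simp add: frac_le)
  finally have "real k * (1 - 1 / real k) \<le> real k * (1 + harm (n - 1) - harm k)"
    by (intro mult_left_mono) auto
  then show ?thesis
    using assms by (simp add: right_diff_distrib)
qed

text \<open>For \<open>k = 1\<close> the preceding bound gives only 0; strictness then comes from
  \<open>harm (n - 1) > 0\<close>, which is where \<open>n \<ge> 2\<close> enters.\<close>

lemma average_bound_pos:
  assumes "n \<ge> 2" "1 \<le> k" "k \<le> n"
  shows "0 < real k * (1 + harm (n - 1) - harm k :: real)"
proof (cases "k = 1")
  case True
  then show ?thesis using assms by (simp add: harm_pos harm_expand)
next
  case False
  then show ?thesis using average_bound_ge_pred[of n k] assms by linarith
qed

lemma increment_step_sum_le:
  assumes "increment_step n x y" "S \<subseteq> {1..n}"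
  shows "sum y S \<le> sum x S + 1"
proof -
  obtain d where d: "\<forall>i\<in>{1..n}. 0 \<le> d i" "(\<Sum>i=1..n. d i) \<le> 1" "\<forall>i\<in>{1..n}. y i = x i + d i"
    using assms(1) unfolding increment_step_def by blast
  have "sum y S = (\<Sum>i\<in>S. x i + d i)"
    using assms(2) d(3) by (intro sum.cong) auto
  also have "\<dots> = sum x S + sum d S"
    by (simp add: sum.distrib)
  also have "sum d S \<le> (\<Sum>i=1..n. d i)"
    using assms(2) d(1) by (intro sum_mono2) auto
  finally show ?thesis using d(2) by linarith
qed

lemma averages_bounded_round:
  assumes n: "n \<ge> 2" and x: "averages_bounded n x" and "game_round n x z"
  shows "averages_bounded n z"
  unfolding averages_bounded_def
proof (intro allI impI)
  fix S assume S: "S \<subseteq> {1..n}" "S \<noteq> {}"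
  obtain y m where y: "increment_step n x y" and m: "m \<in> {1..n}" "\<forall>i\<in>{1..n}. y i \<le> y m"
    and zm: "z m = max 0 (y m - 1)" and z: "\<forall>i\<in>{1..n} - {m}. z i = y i"
    using assms(3) unfolding game_round_def subtraction_step_def by blast
  define k where "k = card S"
  have fin: "finite S" using S(1) finite_subset by blast
  have k: "1 \<le> k" "k \<le> n"
    using S fin card_mono[OF _ S(1)] by (auto simp: k_def Suc_le_eq card_gt_0_iff)
  have rest: "sum z (S - {m}) = sum y (S - {m})"
    using S(1) z by (intro sum.cong) auto
  have "sum z S < real k * (1 + harm (n - 1) - harm k)"
  proof (cases "m \<in> S")
    case False
    have "sum y (insert m S) \<le> sum x (insert m S) + 1"
      using increment_step_sum_le[OF y] S(1) m(1) by simp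
    also have "sum x (insert m S) < real (Suc k) * (1 + harm (n - 1) - harm (Suc k))"
      using averages_boundedD[OF x, of "insert m S"] S(1) m(1) fin False by (simp add: k_def)
    \<comment> \<open>Spread over \<open>k + 1\<close> variables, the unit gained is
      \<open>1 / (k + 1)\<close> each, exactly the last term of \<open>harm (Suc k)\<close>.\<close>
    also have "\<dots> + 1 = real (Suc k) * (1 + harm (n - 1) - harm k)"
      by (simp add: harm_Suc field_simps)
    finally have "y m + sum y S < real (Suc k) * (1 + harm (n - 1) - harm k)"
      using False fin by simp
    moreover have "sum y S \<le> real k * y m"
      using sum_bounded_above[of S y "y m"] m(2) S(1) by (auto simp: k_def)
    \<comment> \<open>The comparison of averages with denominators cleared:
      \<open>(k + 1) * sum y S \<le> k * (y m + sum y S)\<close>.\<close>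
    ultimately have "real (Suc k) * sum y S < real k * (real (Suc k) * (1 + harm (n - 1) - harm k))"
      using mult_strict_left_mono[of "y m + sum y S" _ "real k"] k(1)
      by (fastforce simp: algebra_simps)
    then have "real (Suc k) * sum y S < real (Suc k) * (real k * (1 + harm (n - 1) - harm k))"
      by (simp only: mult.left_commute)
    then have "sum y S < real k * (1 + harm (n - 1) - harm k)"
      by (rule mult_left_less_imp_less) simp
    then show ?thesis using rest False by simp
  next
    case True
    have zS: "sum z S = z m + sum y (S - {m})"
      using sum.remove[OF fin True, of z] rest by simp
    show ?thesis
    proof (cases "y m \<ge> 1")
      case ym: True
      \<comment> \<open>As \<open>y m \<ge> 1\<close>, the truncation at 0 is inactive and a full
        unit is removed.\<close>
      have "sum z S = sum y S - 1"
        using zS zm ym sum.remove[OF fin True, of y] by simp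
      also have "\<dots> \<le> sum x S"
        using increment_step_sum_le[OF y S(1)] by simp
      also have "\<dots> < real k * (1 + harm (n - 1) - harm k)"
        using averages_boundedD[OF x S] by (simp add: k_def)
      finally show ?thesis .
    next
      case ym: False
      show ?thesis
      \<comment> \<open>The singleton is treated apart because the strict comparison of sums over
        \<open>S - {m}\<close> needs a nonempty set.\<close>
      proof (cases "S = {m}")
        case True
        then show ?thesis using zS zm ym average_bound_pos[OF n k] by simp
      next
        case Sm: False
        have "sum z S = sum y (S - {m})"
          using zS zm ym by simp
        also have "\<dots> < (\<Sum>i\<in>S - {m}. 1)"
          using m(2) S ym Sm fin by (intro sum_strict_mono) (force+)
        also have "\<dots> = real k - 1"
          using True fin k by (simp add: k_def of_nat_diff)
        also have "\<dots> \<le> real k * (1 + harm (n - 1) - harm k)"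
          using average_bound_ge_pred[of n k] n k by simp
        finally show ?thesis .
      qed
    qed
  qed
  then show "sum z S < real (card S) * (1 + harm (n - 1) - harm (card S))"
    by (simp add: k_def)
qed

lemma after_rounds_averages_bounded:
  assumes "n \<ge> 2" "after_rounds n t x"
  shows "averages_bounded n x"
  using assms(2)
proof induction
  case (start x)
  show ?case
    unfolding averages_bounded_def
  proof (intro allI impI)
    fix S assume S: "S \<subseteq> {1..n}" "S \<noteq> {}"
    have "finite S" using S(1) finite_subset by blast
    then have "1 \<le> card S" "card S \<le> n"
      using S card_mono[OF _ S(1)] by (auto simp: Suc_le_eq card_gt_0_iff)
    moreover have "sum x S = 0"
      using start S(1) by (intro sum.neutral) auto
    ultimately show "sum x S < real (card S) * (1 + harm (n - 1) - harm (card S))"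
      using average_bound_pos[OF assms(1)] by simp
  qed
next
  case (step t x y)
  then show ?case using averages_bounded_round[OF assms(1)] by blast
qed

text \<open>The sequence \<open>harm n - ln n\<close> is decreasing and starts at 1 for
  \<open>n = 1\<close>. The library sequence is indexed from 0, hence the instances \<open>0\<close>
  and \<open>n - 1\<close>.\<close>

lemma harm_le_one_plus_ln:
  assumes "n \<ge> 1"
  shows "(harm n :: real) \<le> 1 + ln (real n)"
  using decseqD[OF decseq_harm_diff_ln, of 0 "n - 1"] assms by (simp add: harm_expand)

theorem theorem4:
  fixes n :: nat
  assumes "n \<ge> 2"
  shows "(\<forall>t\<ge>1. \<forall>x. after_rounds n t x \<longrightarrow> (\<forall>i\<in>{1..n}. x i < (harm (n - 1) :: real))) \<and>
         (harm (n - 1) :: real) \<le> 1 + ln (real (n - 1))"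
proof (intro conjI allI impI ballI)
  fix t x i
  assume "after_rounds n t x" "i \<in> {1..n}"
  then show "x i < (harm (n - 1) :: real)"
    using averages_boundedD[OF after_rounds_averages_bounded[OF assms], of t x "{i}"]
    by (simp add: harm_expand)
next
  show "(harm (n - 1) :: real) \<le> 1 + ln (real (n - 1))"
    using assms by (intro harm_le_one_plus_ln) simp
qed

end
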